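(* Let $n\geqslant 2$ be an integer and let $\mathfrak{a}\colon \mathscr{I}_{\omega}^{n}(\overrightarrow{\mathrm{conv}})\to \mathscr{I}_{\omega}^{n}(\overrightarrow{\mathrm{conv}})$ be an injective endomorphism. Then there exists $i_0\in\omega$ such that $\mathfrak{a}=\mathfrak{e}_{i_0}$, where $\mathfrak{e}_{i_0}\colon \mathscr{I}_{\omega}^{n}(\overrightarrow{\mathrm{conv}})\to \mathscr{I}_{\omega}^{n}(\overrightarrow{\mathrm{conv}})$ is the endomorphism defined by $(\boldsymbol{0})\mathfrak{e}_{i_0}=\boldsymbol{0}$ and $$\begin{pmatrix} i & i+1 & \cdots & i+k\\ j & j+1 & \cdots & j+k\end{pmatrix}\mathfrak{e}_{i_0}=\begin{pmatrix} i+i_0 & i+1+i_0 & \cdots & i+k+i_0\\ j+i_0 & j+1+i_0 & \cdots & j+k+i_0\end{pmatrix}$$ for all $i,j\in\omega$ and $k=0,1,\ldots,n-1$.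
   Context: $\omega$ is the set of all non-negative integers with its usual order $\leqslant$. A subset $X\subseteq\omega$ is order-convex if $x\leqslant z\leqslant y$ and $x,y\in X$ imply $z\in X$. For a positive integer $n$, $\mathscr{I}_{\omega}^{n}(\overrightarrow{\mathrm{conv}})$ is the semigroup of all partial order isomorphisms between order-convex subsets of $(\omega,\leqslant)$ whose domain has at most $n$ elements (including the empty map), under composition of partial maps written on the right: $x(\alpha\beta)=(x\alpha)\beta$ on $\operatorname{dom}(\alpha\beta)=\{y\in\operatorname{dom}\alpha\colon y\alpha\in\operatorname{dom}\beta\}$. The empty partial map is denoted $\boldsymbol{0}$; it is the zero. The non-zero elements are exactly the maps $\begin{pmatrix} i & i+1 & \cdots & i+k\\ j & j+1 & \cdots & j+k\end{pmatrix}$, sending $i+t$ to $j+t$ for $0\leqslant t\leqslant k$, where $i,j\in\omega$ and $0\leqslant k\leqslant n-1$. An endomorphism of a semigroup $S$ is a map $\mathfrak{e}\colon S\to S$ with $(st)\mathfrak{e}=(s)\mathfrak{e}\cdot(t)\mathfrak{e}$ for all $s,t\in S$; the image of $s$ under $\mathfrak{e}$ is written $(s)\mathfrak{e}$. *)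

theory Defs
  imports Main "HOL-Library.FuncSet"
begin

definition order_convex :: "nat set \<Rightarrow> bool" where
  "order_convex X \<longleftrightarrow> (\<forall>x\<in>X. \<forall>y\<in>X. \<forall>z. x \<le> z \<and> z \<le> y \<longrightarrow> z \<in> X)"

text \<open>Injectivity, and hence bijectivity from the domain onto the range, follows from
  the equivalence below by antisymmetry.\<close>

definition partial_order_iso :: "(nat \<rightharpoonup> nat) \<Rightarrow> bool" where
  "partial_order_iso \<alpha> \<longleftrightarrow>
     (\<forall>x\<in>dom \<alpha>. \<forall>y\<in>dom \<alpha>. x \<le> y \<longleftrightarrow> the (\<alpha> x) \<le> the (\<alpha> y))"

definition I_conv :: "nat \<Rightarrow> (nat \<rightharpoonup> nat) set" where
  "I_conv n = {\<alpha>. partial_order_iso \<alpha> \<and> order_convex (dom \<alpha>) \<and> order_convex (ran \<alpha>)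
                  \<and> finite (dom \<alpha>) \<and> card (dom \<alpha>) \<le> n}"

text \<open>Partial maps act on the right, so in a product the left factor is applied first,
  whereas \<open>\<beta> \<circ>\<^sub>m \<alpha>\<close> applies \<open>\<alpha>\<close> first.\<close>

definition pcomp :: "(nat \<rightharpoonup> nat) \<Rightarrow> (nat \<rightharpoonup> nat) \<Rightarrow> (nat \<rightharpoonup> nat)" (infixl "\<cdot>" 70) where
  "\<alpha> \<cdot> \<beta> = \<beta> \<circ>\<^sub>m \<alpha>"

definition semigroup_endomorphism :: "'a set \<Rightarrow> ('a \<Rightarrow> 'a \<Rightarrow> 'a) \<Rightarrow> ('a \<Rightarrow> 'a) \<Rightarrow> bool" where
  "semigroup_endomorphism S m f \<longleftrightarrow>
     f \<in> S \<rightarrow> S \<and> (\<forall>s\<in>S. \<forall>t\<in>S. f (m s t) = m (f s) (f t))"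

text \<open>The map with domain \<open>{i..i + k}\<close> sending \<open>i + t\<close> to \<open>j + t\<close>.\<close>

definition interval_map :: "nat \<Rightarrow> nat \<Rightarrow> nat \<Rightarrow> (nat \<rightharpoonup> nat)" where
  "interval_map i j k = (\<lambda>x. if x \<in> {i..i + k} then Some (j + (x - i)) else None)"

text \<open>The description picks out a unique value because \<open>i\<close>, \<open>j\<close>, \<open>k\<close> are determined by
  \<open>interval_map i j k\<close>; see \<open>shift_endo_interval_map\<close>. Elements of \<open>I_conv n\<close> are covered by
  \<open>I_conv_eq\<close>; values at other arguments are irrelevant.\<close>

definition shift_endo :: "nat \<Rightarrow> (nat \<rightharpoonup> nat) \<Rightarrow> (nat \<rightharpoonup> nat)" where
  "shift_endo i\<^sub>0 \<alpha> =
     (if \<alpha> = Map.empty then Map.empty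
      else (THE \<beta>. \<exists>i j k. \<alpha> = interval_map i j k \<and> \<beta> = interval_map (i + i\<^sub>0) (j + i\<^sub>0) k))"

lemma dom_pcomp: "dom (\<alpha> \<cdot> \<beta>) = {y \<in> dom \<alpha>. the (\<alpha> y) \<in> dom \<beta>}"
  by (auto simp: pcomp_def map_comp_def split: option.splits)

lemma image_the_dom: "(the \<circ> \<alpha>) ` dom \<alpha> = ran \<alpha>"
proof (intro equalityI subsetI)
  fix y assume "y \<in> ran \<alpha>"
  then obtain x where "\<alpha> x = Some y" by (auto simp: ran_def)
  then show "y \<in> (the \<circ> \<alpha>) ` dom \<alpha>" by (intro image_eqI[of _ _ x]) auto
qed (auto intro: ranI)

lemma dom_interval_map: "dom (interval_map i j k) = {i..i + k}"
  by (auto simp: interval_map_def split: if_splits)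

lemma interval_map_neq_empty: "interval_map i j k \<noteq> Map.empty"
  using dom_interval_map[of i j k] by auto

lemma ran_interval_map: "ran (interval_map i j k) = {j..j + k}"
proof
  show "ran (interval_map i j k) \<subseteq> {j..j + k}"
    by (auto simp: interval_map_def ran_def split: if_splits)
  show "{j..j + k} \<subseteq> ran (interval_map i j k)"
  proof
    fix y assume "y \<in> {j..j + k}"
    then have "interval_map i j k (i + (y - j)) = Some y"
      by (auto simp: interval_map_def)
    then show "y \<in> ran (interval_map i j k)" by (rule ranI)
  qed
qed

lemma interval_map_inject:
  "interval_map i j k = interval_map i' j' k' \<longleftrightarrow> i = i' \<and> j = j' \<and> k = k'"
proof
  assume eq: "interval_map i j k = interval_map i' j' k'"
  have "{i..i + k} = {i'..i' + k'}" "{j..j + k} = {j'..j' + k'}"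
    using dom_interval_map ran_interval_map eq by metis+
  then show "i = i' \<and> j = j' \<and> k = k'" by (simp add: Icc_eq_Icc)
qed simp

lemma shift_endo_empty [simp]: "shift_endo i\<^sub>0 Map.empty = Map.empty"
  by (simp add: shift_endo_def)

lemma shift_endo_interval_map [simp]:
  "shift_endo i\<^sub>0 (interval_map i j k) = interval_map (i + i\<^sub>0) (j + i\<^sub>0) k"
  by (auto simp: shift_endo_def interval_map_neq_empty interval_map_inject)

lemma order_convex_atLeastAtMost: "order_convex {a..b}"
  by (auto simp: order_convex_def)

lemma order_convex_interval:
  assumes "order_convex X" "finite X" "X \<noteq> {}"
  shows "\<exists>i k. X = {i..i + k}"
proof -
  have "X = {Min X..Max X}"
  proof (intro equalityI subsetI)
    fix z assume "z \<in> {Min X..Max X}"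
    then show "z \<in> X"
      using assms(1) Min_in[OF assms(2,3)] Max_in[OF assms(2,3)]
      unfolding order_convex_def by (metis atLeastAtMost_iff)
  qed (use assms in simp)
  moreover have "Min X \<le> Max X" using assms by simp
  ultimately have "X = {Min X..Min X + (Max X - Min X)}" by simp
  then show ?thesis by blast
qed

lemma interval_map_in_I_conv: "interval_map i j k \<in> I_conv n \<longleftrightarrow> k < n"
proof -
  have "partial_order_iso (interval_map i j k)"
    unfolding partial_order_iso_def dom_interval_map by (auto simp: interval_map_def)
  then show ?thesis
    by (auto simp: I_conv_def dom_interval_map ran_interval_map order_convex_atLeastAtMost)
qed

lemma empty_in_I_conv: "Map.empty \<in> I_conv n"
  by (simp add: I_conv_def partial_order_iso_def order_convex_def)

lemma I_conv_eq: "I_conv n = insert Map.empty {interval_map i j k |i j k. k < n}"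
proof (intro equalityI subsetI)
  fix \<alpha> assume a: "\<alpha> \<in> I_conv n"
  show "\<alpha> \<in> insert Map.empty {interval_map i j k |i j k. k < n}"
  proof (cases "\<alpha> = Map.empty")
    case False
    have fin: "finite (dom \<alpha>)" "finite (ran \<alpha>)"
      using a by (auto simp: I_conv_def intro: finite_ran)
    have ne: "dom \<alpha> \<noteq> {}" "ran \<alpha> \<noteq> {}" using False by (auto simp: ran_def) (meson ext not_None_eq)
    obtain i k where D: "dom \<alpha> = {i..i + k}"
      using order_convex_interval[OF _ fin(1) ne(1)] a by (auto simp: I_conv_def)
    obtain j l where R: "ran \<alpha> = {j..j + l}"
      using order_convex_interval[OF _ fin(2) ne(2)] a by (auto simp: I_conv_def)
    have im: "(the \<circ> \<alpha>) ` {i..i + k} = {j..j + l}"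
      unfolding D[symmetric] R[symmetric] by (rule image_the_dom)
    have ord: "x \<le> y \<longleftrightarrow> the (\<alpha> x) \<le> the (\<alpha> y)" if "x \<in> {i..i+k}" "y \<in> {i..i+k}" for x y
    proof -
      have "partial_order_iso \<alpha>" using a by (simp add: I_conv_def)
      then show ?thesis using that unfolding partial_order_iso_def D by blast
    qed
    have val: "the (\<alpha> (i + t)) = j + t" if "t \<le> k" for t
      using that
    proof (induction t)
      case 0
      have "j \<in> {j..j+l}" by simp
      then obtain x where x: "x \<in> {i..i+k}" "the (\<alpha> x) = j"
        unfolding im[symmetric] by auto
      have "the (\<alpha> i) \<le> j" using ord[of i x] x by auto
      moreover have "the (\<alpha> i) \<in> {j..j+l}" unfolding im[symmetric] by auto
      ultimately show ?case by auto
    next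
      case (Suc t)
      then have t: "the (\<alpha> (i + t)) = j + t" by simp
      have lt: "j + t < the (\<alpha> (i + Suc t))"
        using ord[of "i + Suc t" "i + t"] Suc.prems t by auto
      have "the (\<alpha> (i + Suc t)) \<in> {j..j+l}" unfolding im[symmetric] using Suc.prems by auto
      then have "j + Suc t \<in> {j..j+l}" using lt by auto
      then obtain x where x: "x \<in> {i..i+k}" "the (\<alpha> x) = j + Suc t"
        unfolding im[symmetric] by auto
      have "\<not> x \<le> i + t" using ord[of x "i + t"] x t Suc.prems by auto
      then have "the (\<alpha> (i + Suc t)) \<le> j + Suc t"
        using ord[of "i + Suc t" x] x Suc.prems by auto
      then show ?case using lt by auto
    qed
    have "\<alpha> = interval_map i j k"
    proof
      fix x show "\<alpha> x = interval_map i j k x"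
      proof (cases "x \<in> {i..i+k}")
        case True
        then have "\<alpha> x \<noteq> None" using D by blast
        then show ?thesis using val[of "x - i"] True by (auto simp: interval_map_def)
      next
        case F: False
        then have "x \<notin> dom \<alpha>" using D by simp
        then show ?thesis using F unfolding interval_map_def domIff by simp
      qed
    qed
    then show ?thesis using a interval_map_in_I_conv by blast
  qed simp
qed (auto simp: interval_map_in_I_conv empty_in_I_conv)

lemma pcomp_interval_map:
  fixes i j k p q l :: nat
  defines "a \<equiv> max j p" and "b \<equiv> min (j + k) (p + l)"
  shows "interval_map i j k \<cdot> interval_map p q l =
     (if a \<le> b then interval_map (i + (a - j)) (q + (a - p)) (b - a) else Map.empty)"
proof
  fix x
  have "(interval_map i j k \<cdot> interval_map p q l) x =
     (if i \<le> x \<and> x \<le> i + k \<and> p \<le> j + (x - i) \<and> j + (x - i) \<le> p + l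
      then Some (q + (j + (x - i) - p)) else None)"
    by (simp add: pcomp_def map_comp_def interval_map_def)
  also have "\<dots> = (if a \<le> b then interval_map (i + (a - j)) (q + (a - p)) (b - a) else Map.empty) x"
  proof (cases "i \<le> x \<and> x \<le> i + k \<and> p \<le> j + (x - i) \<and> j + (x - i) \<le> p + l")
    case True
    then have "a \<le> b" "i + (a - j) \<le> x" "x \<le> i + (a - j) + (b - a)"
      "q + (j + (x - i) - p) = q + (a - p) + (x - (i + (a - j)))"
      unfolding a_def b_def by linarith+
    with True show ?thesis by (simp add: interval_map_def)
  next
    case False
    then have "\<not> (a \<le> b \<and> i + (a - j) \<le> x \<and> x \<le> i + (a - j) + (b - a))"
      unfolding a_def b_def by linarith
    with False show ?thesis
      by (auto simp only: interval_map_def atLeastAtMost_iff split: if_split)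
  qed
  finally show "(interval_map i j k \<cdot> interval_map p q l) x =
     (if a \<le> b then interval_map (i + (a - j)) (q + (a - p)) (b - a) else Map.empty) x" .
qed

lemma pcomp_empty [simp]: "Map.empty \<cdot> \<alpha> = Map.empty" "\<alpha> \<cdot> Map.empty = Map.empty"
  by (auto simp: pcomp_def map_comp_def split: option.splits)

lemma pcomp_assoc: "(\<alpha> \<cdot> \<beta>) \<cdot> \<gamma> = \<alpha> \<cdot> (\<beta> \<cdot> \<gamma>)"
  by (rule ext) (auto simp: pcomp_def map_comp_def split: option.splits)

lemma pcomp_in_I_conv:
  assumes "\<alpha> \<in> I_conv n" "\<beta> \<in> I_conv n"
  shows "\<alpha> \<cdot> \<beta> \<in> I_conv n"
proof (cases "\<alpha> = Map.empty \<or> \<beta> = Map.empty")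
  case True
  then show ?thesis by (auto simp: empty_in_I_conv)
next
  case False
  with assms obtain i j k p q l where
    "\<alpha> = interval_map i j k" "\<beta> = interval_map p q l" "k < n" "l < n"
    by (auto simp: I_conv_eq)
  moreover have "min (j + k) (p + l) - max j p < n" using \<open>k < n\<close> by linarith
  ultimately show ?thesis
    by (simp add: pcomp_interval_map interval_map_in_I_conv empty_in_I_conv)
qed

lemma semigroup_endomorphism_shift_endo:
  "semigroup_endomorphism (I_conv n) (\<cdot>) (shift_endo i\<^sub>0)"
  unfolding semigroup_endomorphism_def
proof (intro conjI ballI funcsetI)
  fix \<alpha> assume "\<alpha> \<in> I_conv n"
  then show "shift_endo i\<^sub>0 \<alpha> \<in> I_conv n" unfolding I_conv_eq by auto
next
  fix \<alpha> \<beta> assume ab: "\<alpha> \<in> I_conv n" "\<beta> \<in> I_conv n"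
  show "shift_endo i\<^sub>0 (\<alpha> \<cdot> \<beta>) = shift_endo i\<^sub>0 \<alpha> \<cdot> shift_endo i\<^sub>0 \<beta>"
  proof (cases "\<alpha> = Map.empty \<or> \<beta> = Map.empty")
    case True
    then show ?thesis by auto
  next
    case False
    with ab obtain i j k p q l where
      *: "\<alpha> = interval_map i j k" "\<beta> = interval_map p q l"
      by (auto simp: I_conv_eq)
    have m: "max (j + i\<^sub>0) (p + i\<^sub>0) = max j p + i\<^sub>0"
      "min (j + i\<^sub>0 + k) (p + i\<^sub>0 + l) = min (j + k) (p + l) + i\<^sub>0" by linarith+
    show ?thesis
      unfolding * shift_endo_interval_map pcomp_interval_map m
      by (simp add: algebra_simps)
  qed
qed

end

theory Submission
  imports Defs
begin

text \<open>Every idempotent of \<open>I_conv n\<close> is a partial identity, so a strict chain of idempotents has at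
  most \<open>n + 1\<close> members, and an injective endomorphism preserves the rank of each member of a maximal
  chain. In particular it fixes the empty map and induces an injection \<open>f\<close> on the points of \<open>\<omega>\<close>.
  The identity of \<open>{i, i + 1}\<close> goes to the identity of a two-point interval containing \<open>f i\<close> and
  \<open>f (i + 1)\<close>, so consecutive values of \<open>f\<close> differ by one; by injectivity \<open>f\<close> cannot turn around,
  and it cannot decrease forever. Hence \<open>f\<close> is a shift, and it determines the images of all longer
  intervals.\<close>

section \<open>Sequences of natural numbers\<close>

lemma strict_chain_eq_id:
  fixes g :: "nat \<Rightarrow> nat"
  assumes step: "\<And>m. m < n \<Longrightarrow> g m < g (Suc m)" and bound: "g n \<le> n" and "m \<le> n"
  shows "g m = m"
proof (rule antisym)
  show "m \<le> g m" using \<open>m \<le> n\<close>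
  proof (induction m)
    case (Suc m)
    then show ?case using step[of m] by simp
  qed simp
  \<comment> \<open>Decreasing induction from \<open>n\<close>: strict growth has to fit below the
    bound on \<open>g n\<close>.\<close>
  show "g m \<le> m" using \<open>m \<le> n\<close>
  proof (induction m rule: inc_induct)
    case (step m)
    then show ?case using assms(1)[of m] by simp
  qed (rule bound)
qed

lemma unit_steps_inj_eq_shift:
  fixes f :: "nat \<Rightarrow> nat"
  assumes "inj f" and unit: "\<And>i. f (Suc i) = Suc (f i) \<or> f i = Suc (f (Suc i))"
  shows "f i = i + f 0"
proof -
  have keep: "f (Suc (Suc i)) = Suc (f (Suc i)) \<longleftrightarrow> f (Suc i) = Suc (f i)" for i
  proof -
    \<comment> \<open>Two consecutive unit steps of opposite direction would return to the value
      \<open>f i\<close>.\<close>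
    have "f (Suc (Suc i)) \<noteq> f i" using \<open>inj f\<close> by (simp add: inj_eq)
    then show ?thesis using unit[of i] unit[of "Suc i"] by linarith
  qed
  have same: "f (Suc i) = Suc (f i) \<longleftrightarrow> f (Suc 0) = Suc (f 0)" for i
    by (induction i) (simp_all add: keep)
  have up: "f (Suc 0) = Suc (f 0)"
  proof (rule ccontr)
    assume "f (Suc 0) \<noteq> Suc (f 0)"
    then have down: "f i = Suc (f (Suc i))" for i using same unit by blast
    have "f 0 = f i + i" for i
    proof (induction i)
      case (Suc i)
      then show ?case using down[of i] by simp
    qed simp
    from this[of "Suc (f 0)"] show False by simp
  qed
  show ?thesis
  proof (induction i)
    case (Suc i)
    then show ?case using same[of i] up by simp
  qed simp
qed

section \<open>Products and idempotents of the semigroup\<close>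

lemma I_conv_cases:
  assumes "\<alpha> \<in> I_conv n"
  obtains "\<alpha> = Map.empty" | i j k where "\<alpha> = interval_map i j k" "k < n"
  using assms unfolding I_conv_eq by blast

text \<open>Maps of equal rank multiply like matrix units when range and domain match; so
  \<open>interval_map i i k\<close> is idempotent, and swapping the first two arguments gives the
  inverse.\<close>

lemma pcomp_matching: "interval_map i j k \<cdot> interval_map j l k = interval_map i l k"
  by (simp add: pcomp_interval_map)

lemma pcomp_nested:
  assumes "p \<le> i" "i + k \<le> p + l"
  shows "interval_map i i k \<cdot> interval_map p p l = interval_map i i k"
proof -
  have "max i p = i" "min (i + k) (p + l) = i + k" using assms by linarith+
  then show ?thesis using assms by (simp add: pcomp_interval_map)
qed

lemma dom_pcomp_subset: "dom (\<alpha> \<cdot> \<beta>) \<subseteq> dom \<alpha>"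
  by (auto simp: dom_pcomp)

lemma ran_pcomp_subset: "ran (\<alpha> \<cdot> \<beta>) \<subseteq> ran \<beta>"
  by (auto simp: pcomp_def map_comp_def ran_def split: option.splits)

lemma idempotent_cases:
  assumes "\<alpha> \<in> I_conv n" "\<alpha> \<cdot> \<alpha> = \<alpha>"
  obtains "\<alpha> = Map.empty" | i k where "\<alpha> = interval_map i i k" "k < n"
  using assms(1)
proof (cases rule: I_conv_cases)
  case (2 i j k)
  have eq: "interval_map i j k \<cdot> interval_map i j k = interval_map i j k"
    using assms(2) unfolding 2 .
  \<comment> \<open>Comparing left ends of domain and range: the first equation forces
    \<open>i \<le> j\<close>, the second \<open>j \<le> i\<close>.\<close>
  then have "i + (max j i - j) = i \<and> j + (max j i - i) = j"
    unfolding pcomp_interval_map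
    by (auto simp: interval_map_inject interval_map_neq_empty[symmetric] split: if_splits)
  then have "i = j" by linarith
  with 2 that show ?thesis by blast
qed (use that in blast)

lemma idempotent_dom_eq_ran:
  assumes "\<alpha> \<in> I_conv n" "\<alpha> \<cdot> \<alpha> = \<alpha>"
  shows "dom \<alpha> = ran \<alpha>"
  using assms by (cases rule: idempotent_cases) (simp_all add: dom_interval_map ran_interval_map)

lemma idempotent_eqI:
  assumes "\<alpha> \<in> I_conv n" "\<alpha> \<cdot> \<alpha> = \<alpha>" "\<beta> \<in> I_conv n" "\<beta> \<cdot> \<beta> = \<beta>" "dom \<alpha> = dom \<beta>"
  shows "\<alpha> = \<beta>"
  using assms(1,2)
proof (cases rule: idempotent_cases)
  case 1
  then have "dom \<beta> = {}" using assms(5) by simp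
  with 1 show ?thesis by simp
next
  case a: (2 i k)
  from assms(3,4) show ?thesis
  proof (cases rule: idempotent_cases)
    case 1
    then have "dom \<alpha> = {}" using assms(5) by simp
    with 1 show ?thesis by simp
  next
    case (2 i' k')
    then show ?thesis using a assms(5) by (auto simp: dom_interval_map Icc_eq_Icc)
  qed
qed

lemma card_dom_idempotent_less:
  assumes "\<alpha> \<in> I_conv n" "\<alpha> \<cdot> \<alpha> = \<alpha>" "\<beta> \<in> I_conv n" "\<beta> \<cdot> \<beta> = \<beta>"
    and "\<alpha> \<cdot> \<beta> = \<alpha>" "\<alpha> \<noteq> \<beta>"
  shows "card (dom \<alpha>) < card (dom \<beta>)"
proof (rule psubset_card_mono)
  show "finite (dom \<beta>)" using assms(3) by (simp add: I_conv_def)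
  \<comment> \<open>The factor \<open>\<beta>\<close> on the right controls only ranges; for
    idempotents these are the domains.\<close>
  have "ran \<alpha> \<subseteq> ran \<beta>" using ran_pcomp_subset[of \<alpha> \<beta>] assms(5) by simp
  moreover have "dom \<alpha> \<noteq> dom \<beta>" using idempotent_eqI assms by blast
  ultimately show "dom \<alpha> \<subset> dom \<beta>"
    using idempotent_dom_eq_ran[OF assms(1,2)] idempotent_dom_eq_ran[OF assms(3,4)] by blast
qed

section \<open>Ranks and intervals under an injective endomorphism\<close>

locale injective_endomorphism =
  fixes n :: nat and h :: "(nat \<rightharpoonup> nat) \<Rightarrow> (nat \<rightharpoonup> nat)"
  assumes endo: "semigroup_endomorphism (I_conv n) (\<cdot>) h"
    and inj: "inj_on h (I_conv n)"
begin

lemma h_in: "\<alpha> \<in> I_conv n \<Longrightarrow> h \<alpha> \<in> I_conv n"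
  using endo by (auto simp: semigroup_endomorphism_def)

lemma h_mult: "\<alpha> \<in> I_conv n \<Longrightarrow> \<beta> \<in> I_conv n \<Longrightarrow> h (\<alpha> \<cdot> \<beta>) = h \<alpha> \<cdot> h \<beta>"
  using endo by (simp add: semigroup_endomorphism_def)

text \<open>A chain of idempotents indexed by rank: the index counts points, so it is one more than
  the length argument of \<open>interval_map\<close>, and index 0 is the zero.\<close>

definition chain :: "nat \<Rightarrow> nat \<Rightarrow> (nat \<rightharpoonup> nat)" where
  "chain i m = (case m of 0 \<Rightarrow> Map.empty | Suc k \<Rightarrow> interval_map i i k)"

lemma card_dom_h_chain:
  assumes "m \<le> n"
  shows "card (dom (h (chain i m))) = m"
proof (rule strict_chain_eq_id[where g = "\<lambda>m. card (dom (h (chain i m)))" and n = n])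
  have mem: "chain i m \<in> I_conv n" if "m \<le> n" for m
    using that by (cases m) (auto simp: chain_def empty_in_I_conv interval_map_in_I_conv)
  have idem: "chain i m \<cdot> chain i m = chain i m" for m
    by (cases m) (simp_all add: chain_def pcomp_matching)
  show "card (dom (h (chain i n))) \<le> n" using h_in[OF mem[of n]] by (simp add: I_conv_def)
  fix m assume "m < n"
  then have m: "chain i m \<in> I_conv n" and Sm: "chain i (Suc m) \<in> I_conv n" by (simp_all add: mem)
  show "card (dom (h (chain i m))) < card (dom (h (chain i (Suc m))))"
  proof (rule card_dom_idempotent_less[OF h_in[OF m] _ h_in[OF Sm]])
    have "chain i m \<cdot> chain i (Suc m) = chain i m"
      by (cases m) (simp_all add: chain_def pcomp_nested)
    then show "h (chain i m) \<cdot> h (chain i (Suc m)) = h (chain i m)"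
      using h_mult[OF m Sm] by simp
    have "chain i m \<noteq> chain i (Suc m)"
      by (cases m) (simp_all add: chain_def interval_map_inject interval_map_neq_empty[symmetric])
    then show "h (chain i m) \<noteq> h (chain i (Suc m))" using inj_onD[OF inj _ m Sm] by blast
  qed (use h_mult[OF m m] h_mult[OF Sm Sm] idem in simp_all)
qed fact

lemma h_empty: "h Map.empty = Map.empty"
proof -
  have "card (dom (h Map.empty)) = 0" using card_dom_h_chain[of 0 0] by (simp add: chain_def)
  moreover have "finite (dom (h Map.empty))"
    using h_in[OF empty_in_I_conv] by (simp add: I_conv_def)
  ultimately show ?thesis by simp
qed

text \<open>For \<open>k < n\<close> the image of \<open>interval_map i i k\<close> is again a
  partial identity on \<open>k + 1\<close> points, so its left end determines it. The case
  \<open>k = 0\<close> is the point map \<open>f\<close> of the overview.\<close>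

definition left_end :: "nat \<Rightarrow> nat \<Rightarrow> nat" where
  "left_end k i = Min (dom (h (interval_map i i k)))"

lemma h_identity:
  assumes "k < n"
  shows "h (interval_map i i k) = interval_map (left_end k i) (left_end k i) k"
proof -
  let ?e = "interval_map i i k"
  have e: "?e \<in> I_conv n" using assms by (simp add: interval_map_in_I_conv)
  have "h ?e \<cdot> h ?e = h ?e" using h_mult[OF e e] by (simp add: pcomp_matching)
  with h_in[OF e] have "\<exists>p. h ?e = interval_map p p k"
  proof (cases rule: idempotent_cases)
    case 1
    then show ?thesis using card_dom_h_chain[of "Suc k" i] assms by (simp add: chain_def)
  next
    case (2 p l)
    then show ?thesis using card_dom_h_chain[of "Suc k" i] assms
      by (auto simp: chain_def dom_interval_map)
  qed
  then obtain p where p: "h ?e = interval_map p p k" by blast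
  have "Min {p..p + k} = p" by (rule Min_eqI) auto
  with p show ?thesis by (simp add: left_end_def dom_interval_map)
qed

text \<open>Multiplying by the inverse or by an identity of the same rank shows that the image has
  the domain of the image of one identity and the range of that of the other; domain and range
  determine an element of \<open>I_conv n\<close>.\<close>

lemma h_interval_map:
  assumes "k < n"
  shows "h (interval_map i j k) = interval_map (left_end k i) (left_end k j) k"
proof -
  have mem: "interval_map p q k \<in> I_conv n" for p q
    using assms by (simp add: interval_map_in_I_conv)
  have mult: "h (interval_map p q k) \<cdot> h (interval_map q r k) = h (interval_map p r k)" for p q r
    using h_mult[OF mem mem, of p q q r] by (simp add: pcomp_matching)
  let ?a = "h (interval_map i j k)"
  have "dom ?a = dom (h (interval_map i i k))"
    using dom_pcomp_subset[of ?a "h (interval_map j i k)"]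
      dom_pcomp_subset[of "h (interval_map i i k)" ?a]
    unfolding mult by (rule antisym[rotated])
  then have dom: "dom ?a = {left_end k i..left_end k i + k}"
    using h_identity[OF assms] by (simp add: dom_interval_map)
  have "ran ?a = ran (h (interval_map j j k))"
    using ran_pcomp_subset[of "h (interval_map j i k)" ?a]
      ran_pcomp_subset[of ?a "h (interval_map j j k)"]
    unfolding mult by (rule antisym[rotated])
  then have ran: "ran ?a = {left_end k j..left_end k j + k}"
    using h_identity[OF assms] by (simp add: ran_interval_map)
  from h_in[OF mem[of i j]] show ?thesis
  proof (cases rule: I_conv_cases)
    case 1
    then show ?thesis using dom by simp
  next
    case (2 p q l)
    then show ?thesis using dom ran by (auto simp: dom_interval_map ran_interval_map Icc_eq_Icc)
  qed
qed

section \<open>The action on points\<close>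

lemma left_end_point_mem:
  assumes "k < n" "i \<le> x" "x \<le> i + k"
  shows "left_end 0 x \<in> {left_end k i..left_end k i + k}"
proof -
  have x: "interval_map x x 0 \<in> I_conv n" and e: "interval_map i i k \<in> I_conv n"
    using assms(1) by (simp_all add: interval_map_in_I_conv)
  \<comment> \<open>The identity of a point lies below that of any interval containing it, and
    products express this order.\<close>
  have "h (interval_map x x 0) \<cdot> h (interval_map i i k) = h (interval_map x x 0)"
    using h_mult[OF x e] assms by (simp add: pcomp_nested)
  then have "ran (h (interval_map x x 0)) \<subseteq> ran (h (interval_map i i k))"
    by (metis ran_pcomp_subset)
  then show ?thesis using assms(1) by (simp add: h_interval_map ran_interval_map)
qed

lemma left_end_point:
  assumes "n \<ge> 2"
  shows "left_end 0 i = i + left_end 0 0"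
proof (rule unit_steps_inj_eq_shift)
  show "inj (left_end 0)"
  proof (rule injI)
    fix x y assume "left_end 0 x = left_end 0 y"
    then have "h (interval_map x x 0) = h (interval_map y y 0)"
      using assms by (simp add: h_interval_map)
    then have "interval_map x x 0 = interval_map y y 0"
      using inj_onD[OF inj] assms by (simp add: interval_map_in_I_conv)
    then show "x = y" by (simp add: interval_map_inject)
  qed
  fix i
  have "left_end 0 i \<noteq> left_end 0 (Suc i)" using \<open>inj (left_end 0)\<close> by (simp add: inj_eq)
  \<comment> \<open>Here \<open>n \<ge> 2\<close> puts the two-point identities, with
    \<open>k = 1\<close>, into the semigroup; distinct points of a two-point interval are
    neighbours.\<close>
  moreover have "left_end 0 i \<in> {left_end 1 i..left_end 1 i + 1}"
    "left_end 0 (Suc i) \<in> {left_end 1 i..left_end 1 i + 1}"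
    using assms by (intro left_end_point_mem; simp)+
  ultimately show "left_end 0 (Suc i) = Suc (left_end 0 i) \<or> left_end 0 i = Suc (left_end 0 (Suc i))"
    by auto
qed

text \<open>The images of the points \<open>i\<close> and \<open>i + k\<close> are \<open>k\<close>
  apart and lie in one interval of \<open>k + 1\<close> points, so they are its ends.\<close>

lemma left_end_shift:
  assumes "n \<ge> 2" "k < n"
  shows "left_end k i = i + left_end 0 0"
  using left_end_point_mem[OF assms(2), of i i] left_end_point_mem[OF assms(2), of i "i + k"]
    left_end_point[OF assms(1), of i] left_end_point[OF assms(1), of "i + k"]
  by simp

lemma h_eq_shift_endo:
  assumes "n \<ge> 2" "\<alpha> \<in> I_conv n"
  shows "h \<alpha> = shift_endo (left_end 0 0) \<alpha>"
  using assms(2)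
proof (cases rule: I_conv_cases)
  case 1
  then show ?thesis by (simp add: h_empty)
next
  case (2 i j k)
  then show ?thesis by (simp add: h_interval_map left_end_shift[OF assms(1) 2(2)])
qed

end

theorem theorem1:
  fixes n :: nat and \<aa> :: "(nat \<rightharpoonup> nat) \<Rightarrow> (nat \<rightharpoonup> nat)"
  assumes "n \<ge> 2"
    and "semigroup_endomorphism (I_conv n) (\<cdot>) \<aa>"
    and "inj_on \<aa> (I_conv n)"
  shows "\<exists>i\<^sub>0. \<forall>\<alpha>\<in>I_conv n. \<aa> \<alpha> = shift_endo i\<^sub>0 \<alpha>"
proof -
  interpret injective_endomorphism n \<aa> using assms(2,3) by unfold_locales
  show ?thesis using h_eq_shift_endo[OF assms(1)] by blast
qed

end
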